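(* Let $\mathcal A$ be a nonempty finite set and let $g_m>0$, $h_m\in\mathbb C\setminus\{0\}$, $P_m>0$ for $m\in\mathcal A$. For $\sigma^2>0$ let $(\{p_m^\star\}_{m\in\mathcal A},\eta^\star)$ (depending on $\sigma^2$) be the optimal solution of $$\min_{\{p_m\},\,\eta}\ \sum_{m\in\mathcal A}\Big(\frac{|h_m|\sqrt{p_m}}{\eta}-g_m\Big)^2+\frac{\sigma^2}{\eta^2}\quad\text{s.t. } 0\le p_m\le P_m\ (m\in\mathcal A),\ \ \eta>0 .$$ Let $\tau_{(1)}=\min_{m\in\mathcal A}\frac{|h_m|\sqrt{P_m}}{g_m}$. (i) (High-SNR regime) As $\sigma^2\to0^+$, $$\eta^\star\to\tau_{(1)},\qquad p_m^\star\to\Big(\frac{\tau_{(1)}g_m}{|h_m|}\Big)^2\quad\text{for every } m\in\mathcal A .$$ (ii) (Low-SNR regime) For all sufficiently large $\sigma^2$, $$p_m^\star=P_m\ \text{ for every } m\in\mathcal A,\qquad \eta^\star=\frac{\sum_{m\in\mathcal A}|h_m|^2P_m+\sigma^2}{\sum_{m\in\mathcal A}|h_m|\sqrt{P_m}\,g_m}.$$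
   Context: All notions are defined in the claim. The quantity $\sigma^2$ is a noise variance, $p_m$ is the transmit power of device $m$, and $\eta$ is the denoising factor. *)

theory Defs
  imports "HOL-Analysis.Analysis"
begin

definition ota_objective ::
  "'m set \<Rightarrow> ('m \<Rightarrow> real) \<Rightarrow> ('m \<Rightarrow> complex) \<Rightarrow> real \<Rightarrow> ('m \<Rightarrow> real) \<Rightarrow> real \<Rightarrow> real"
where
  "ota_objective A g h \<sigma>2 p \<eta> =
     (\<Sum>m\<in>A. (cmod (h m) * sqrt (p m) / \<eta> - g m)\<^sup>2) + \<sigma>2 / \<eta>\<^sup>2"

definition ota_feasible ::
  "'m set \<Rightarrow> ('m \<Rightarrow> real) \<Rightarrow> ('m \<Rightarrow> real) \<Rightarrow> real \<Rightarrow> bool"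
where
  "ota_feasible A P p \<eta> \<longleftrightarrow> (\<forall>m\<in>A. 0 \<le> p m \<and> p m \<le> P m) \<and> \<eta> > 0"

text \<open>
  Power allocations are total functions on the type of devices; their values outside \<open>A\<close>
  occur neither in the objective nor in the constraints.
\<close>

definition ota_optimal ::
  "'m set \<Rightarrow> ('m \<Rightarrow> real) \<Rightarrow> ('m \<Rightarrow> complex) \<Rightarrow> ('m \<Rightarrow> real) \<Rightarrow> real
     \<Rightarrow> ('m \<Rightarrow> real) \<Rightarrow> real \<Rightarrow> bool"
where
  "ota_optimal A g h P \<sigma>2 p \<eta> \<longleftrightarrow>
     is_arg_min (\<lambda>(p, \<eta>). ota_objective A g h \<sigma>2 p \<eta>) (\<lambda>(p, \<eta>). ota_feasible A P p \<eta>) (p, \<eta>)"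

definition tau_min ::
  "'m set \<Rightarrow> ('m \<Rightarrow> real) \<Rightarrow> ('m \<Rightarrow> complex) \<Rightarrow> ('m \<Rightarrow> real) \<Rightarrow> real"
where
  "tau_min A g h P = Min ((\<lambda>m. cmod (h m) * sqrt (P m) / g m) ` A)"

text \<open>
  The next two lemmas justify speaking of \<^emph>\<open>the\<close> optimal solution: for every positive noise
  variance one exists, and it is unique up to the irrelevant values outside \<open>A\<close>.
\<close>

lemma ota_optimal_iff:
  "ota_optimal A g h P s p e \<longleftrightarrow> ota_feasible A P p e \<and>
     (\<forall>q f. ota_feasible A P q f \<longrightarrow> ota_objective A g h s p e \<le> ota_objective A g h s q f)"
  unfolding ota_optimal_def is_arg_min_def by (auto simp: not_less)

lemma ota_optimal_unique:
  fixes g :: "'m \<Rightarrow> real"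
  assumes fin: "finite A" and h: "\<And>m. m \<in> A \<Longrightarrow> h m \<noteq> 0" and s: "s > 0"
    and o1: "ota_optimal A g h P s p e" and o2: "ota_optimal A g h P s q f"
  shows "e = f" and "\<forall>m\<in>A. p m = q m"
proof -
  have f1: "ota_feasible A P p e" and f2: "ota_feasible A P q f"
    using o1 o2 by (auto simp: ota_optimal_iff)
  have e: "e > 0" and f: "f > 0" using f1 f2 by (auto simp: ota_feasible_def)
  define y where "y = (\<lambda>m. cmod (h m) * sqrt (p m) / e)"
  define z where "z = (\<lambda>m. cmod (h m) * sqrt (q m) / f)"
  define w where "w = (1 / e + 1 / f) / 2"
  have w: "w > 0" using e f by (simp add: w_def add_pos_pos)
  define r where "r = (\<lambda>m. ((y m + z m) / 2 / (w * cmod (h m)))\<^sup>2)"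
  have y0: "0 \<le> y m" "0 \<le> z m" if "m \<in> A" for m
    using that f1 f2 e f by (auto simp: y_def z_def ota_feasible_def)
  have sr: "sqrt (r m) = (y m + z m) / 2 / (w * cmod (h m))" if "m \<in> A" for m
    using y0[OF that] w unfolding r_def by simp
  have rP: "r m \<le> P m" if "m \<in> A" for m
  proof -
    have hm: "cmod (h m) > 0" using h that by simp
    have P: "0 \<le> P m" using f1 that by (force simp: ota_feasible_def)
    have "sqrt (p m) \<le> sqrt (P m)" "sqrt (q m) \<le> sqrt (P m)"
      using f1 f2 that by (auto simp: ota_feasible_def)
    then have "y m \<le> cmod (h m) * sqrt (P m) / e" "z m \<le> cmod (h m) * sqrt (P m) / f"
      using e f hm by (auto simp: y_def z_def intro!: divide_right_mono mult_left_mono)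
    then have "(y m + z m) / 2 \<le> (cmod (h m) * sqrt (P m) / e + cmod (h m) * sqrt (P m) / f) / 2"
      by (intro divide_right_mono add_mono) auto
    moreover have "sqrt (P m) * (w * cmod (h m)) =
        (cmod (h m) * sqrt (P m) / e + cmod (h m) * sqrt (P m) / f) / 2"
      by (simp add: w_def field_simps)
    ultimately have "(y m + z m) / 2 \<le> sqrt (P m) * (w * cmod (h m))" by metis
    then have "sqrt (r m) \<le> sqrt (P m)"
      unfolding sr[OF that] using w hm by (subst pos_divide_le_eq) auto
    then show ?thesis by simp
  qed
  have fr: "ota_feasible A P r (1 / w)"
    using rP w by (auto simp: ota_feasible_def r_def)
  have ob: "ota_objective A g h s r (1 / w) = (\<Sum>m\<in>A. ((y m + z m) / 2 - g m)\<^sup>2) + s * w\<^sup>2"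
  proof -
    have "cmod (h m) * sqrt (r m) / (1 / w) = (y m + z m) / 2" if "m \<in> A" for m
      using sr[OF that] w h[OF that] by simp
    then have "(\<Sum>m\<in>A. (cmod (h m) * sqrt (r m) / (1 / w) - g m)\<^sup>2) =
        (\<Sum>m\<in>A. ((y m + z m) / 2 - g m)\<^sup>2)"
      by (intro sum.cong refl) metis
    moreover have "s / (1 / w)\<^sup>2 = s * w\<^sup>2" by (simp add: power_divide)
    ultimately show ?thesis unfolding ota_objective_def by metis
  qed
  have o1': "ota_objective A g h s p e = (\<Sum>m\<in>A. (y m - g m)\<^sup>2) + s * (1 / e)\<^sup>2"
    by (simp add: ota_objective_def y_def power_divide)
  have o2': "ota_objective A g h s q f = (\<Sum>m\<in>A. (z m - g m)\<^sup>2) + s * (1 / f)\<^sup>2"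
    by (simp add: ota_objective_def z_def power_divide)
  have par: "(\<Sum>m\<in>A. ((y m + z m) / 2 - g m)\<^sup>2) =
      (\<Sum>m\<in>A. (y m - g m)\<^sup>2) / 2 + (\<Sum>m\<in>A. (z m - g m)\<^sup>2) / 2 - (\<Sum>m\<in>A. (y m - z m)\<^sup>2) / 4"
    unfolding sum_divide_distrib sum.distrib[symmetric] sum_subtractf[symmetric]
    by (rule sum.cong) (auto simp: power2_eq_square field_simps)
  have parw: "s * w\<^sup>2 = s * (1 / e)\<^sup>2 / 2 + s * (1 / f)\<^sup>2 / 2 - s * (1 / e - 1 / f)\<^sup>2 / 4"
  proof -
    have "s * ((a + b) / 2)\<^sup>2 = s * a\<^sup>2 / 2 + s * b\<^sup>2 / 2 - s * (a - b)\<^sup>2 / 4" for a b :: real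
      by (simp add: power2_eq_square field_simps)
    then show ?thesis unfolding w_def .
  qed
  have "ota_objective A g h s p e \<le> ota_objective A g h s r (1 / w)"
       "ota_objective A g h s q f \<le> ota_objective A g h s r (1 / w)"
    using o1 o2 fr by (auto simp: ota_optimal_iff)
  then have "(\<Sum>m\<in>A. (y m - z m)\<^sup>2) + s * (1 / e - 1 / f)\<^sup>2 \<le> 0"
    unfolding ob o1' o2' par parw by linarith
  moreover have s0: "0 \<le> (\<Sum>m\<in>A. (y m - z m)\<^sup>2)" by (simp add: sum_nonneg)
  moreover have s1: "0 \<le> s * (1 / e - 1 / f)\<^sup>2" using s by simp
  ultimately have z0: "(\<Sum>m\<in>A. (y m - z m)\<^sup>2) = 0" and z1: "s * (1 / e - 1 / f)\<^sup>2 = 0"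
    by linarith+
  show ef: "e = f" using z1 s by simp
  show "\<forall>m\<in>A. p m = q m"
  proof
    fix m assume m: "m \<in> A"
    have "y m = z m" using z0 m fin by (simp add: sum_nonneg_eq_0_iff)
    then show "p m = q m" using ef e h[OF m] by (simp add: y_def z_def)
  qed
qed

lemma ota_optimal_exists:
  fixes g :: "'m \<Rightarrow> real"
  assumes fin: "finite A" and ne: "A \<noteq> {}" and g: "\<And>m. m \<in> A \<Longrightarrow> g m > 0"
    and h: "\<And>m. m \<in> A \<Longrightarrow> h m \<noteq> 0" and P: "\<And>m. m \<in> A \<Longrightarrow> P m > 0" and s: "s > 0"
  shows "\<exists>p e. ota_optimal A g h P s p e"
proof -
  define X where "X = (\<lambda>m. cmod (h m) * sqrt (P m))"
  have X: "X m > 0" if "m \<in> A" for m using h P that by (simp add: X_def)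
  define F where "F = (\<lambda>u. (\<Sum>m\<in>A. (max 0 (g m - X m * u))\<^sup>2) + s * u\<^sup>2)"
  define G where "G = (\<Sum>m\<in>A. (g m)\<^sup>2)"
  have F0: "F 0 = G" using g by (simp add: F_def G_def max_def less_imp_le cong: sum.cong)
  have lower: "F (1 / f) \<le> ota_objective A g h s q f" if "ota_feasible A P q f" for q f
  proof -
    have f: "f > 0" using that by (simp add: ota_feasible_def)
    have "(max 0 (g m - X m * (1 / f)))\<^sup>2 \<le> (cmod (h m) * sqrt (q m) / f - g m)\<^sup>2" if m: "m \<in> A" for m
    proof -
      have "cmod (h m) * sqrt (q m) / f \<le> X m * (1 / f)"
        using \<open>ota_feasible A P q f\<close> m f
        by (auto simp: X_def ota_feasible_def intro!: divide_right_mono mult_left_mono)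
      then have "\<bar>max 0 (g m - X m * (1 / f))\<bar> \<le> \<bar>cmod (h m) * sqrt (q m) / f - g m\<bar>" by linarith
      then show ?thesis by (simp only: abs_le_square_iff)
    qed
    then show ?thesis unfolding F_def ota_objective_def
      by (simp add: sum_mono power_divide)
  qed
  have G0: "0 \<le> G" by (simp add: G_def sum_nonneg)
  define K where "K = (G + 1) / s + 1"
  have K: "K \<ge> 1" using G0 s by (simp add: K_def)
  have "continuous_on {0..K} F" unfolding F_def by (intro continuous_intros)
  then obtain u where u: "u \<in> {0..K}" and um: "\<And>v. v \<in> {0..K} \<Longrightarrow> F u \<le> F v"
    using continuous_attains_inf[of "{0..K}" F] K by auto
  have uv: "F u \<le> F v" if "v > 0" for v
  proof (cases "v \<le> K")
    case False
    have "G \<le> s * K" using s by (simp add: K_def field_simps)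
    also have "\<dots> \<le> s * v\<^sup>2"
    proof -
      have "K \<le> v" "1 \<le> v" using False K by auto
      then have "K \<le> v * v" using mult_mono[of 1 v K v] K by auto
      then show ?thesis using s by (simp add: power2_eq_square)
    qed
    also have "\<dots> \<le> F v" by (simp add: F_def sum_nonneg)
    finally show ?thesis using um[of 0] K F0 by simp
  qed (use um that in auto)
  have "u \<noteq> 0"
  proof
    assume u0: "u = 0"
    define C where "C = (\<Sum>m\<in>A. (X m)\<^sup>2) + s"
    define D where "D = (\<Sum>m\<in>A. g m * X m)"
    have C: "C > 0" using s by (simp add: C_def add_nonneg_pos sum_nonneg)
    have D: "D > 0" using fin ne g X by (auto simp: D_def intro!: sum_pos)
    define B where "B = Min ((\<lambda>m. g m / X m) ` A)"
    have B: "B > 0" using fin ne g X by (auto simp: B_def)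
    define v where "v = min B (D / C)"
    have v: "v > 0" using B C D by (simp add: v_def)
    have vB: "X m * v \<le> g m" if "m \<in> A" for m
    proof -
      have "v \<le> B" by (simp add: v_def)
      also have "B \<le> g m / X m" using fin that by (simp add: B_def)
      finally show ?thesis using X[OF that] by (simp add: field_simps)
    qed
    have "F v = (\<Sum>m\<in>A. (g m - X m * v)\<^sup>2) + s * v\<^sup>2"
      unfolding F_def using vB by (simp cong: sum.cong)
    also have "(\<Sum>m\<in>A. (g m - X m * v)\<^sup>2) = G - 2 * v * D + v\<^sup>2 * (\<Sum>m\<in>A. (X m)\<^sup>2)"
      unfolding G_def D_def sum_distrib_left sum.distrib[symmetric] sum_subtractf[symmetric]
      by (rule sum.cong) (auto simp: power2_eq_square algebra_simps)
    also have "G - 2 * v * D + v\<^sup>2 * (\<Sum>m\<in>A. (X m)\<^sup>2) + s * v\<^sup>2 = G - v * (2 * D - v * C)"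
      by (simp add: C_def power2_eq_square algebra_simps)
    finally have Fv: "F v = G - v * (2 * D - v * C)" .
    have "v \<le> D / C" by (simp add: v_def)
    then have "v * C \<le> D" using C by (simp add: field_simps)
    then have "0 < v * (2 * D - v * C)" using v D by simp
    then show False using uv[OF v] Fv F0 u0 by simp
  qed
  then have u0: "u > 0" using u by auto
  define p where "p = (\<lambda>m. (min (X m) (g m / u) / cmod (h m))\<^sup>2)"
  have pos: "0 \<le> min (X m) (g m / u)" if "m \<in> A" for m
    using X[OF that] g[OF that] u0 by simp
  have sp: "cmod (h m) * sqrt (p m) = min (X m) (g m / u)" if "m \<in> A" for m
    using pos[OF that] h[OF that] by (simp add: p_def)
  have "p m \<le> P m" if "m \<in> A" for m
  proof -
    have "cmod (h m) * sqrt (p m) \<le> cmod (h m) * sqrt (P m)"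
      unfolding sp[OF that] by (simp add: X_def)
    then show ?thesis using h[OF that] by simp
  qed
  then have fp: "ota_feasible A P p (1 / u)" using u0 by (auto simp: ota_feasible_def p_def)
  have "(cmod (h m) * sqrt (p m) / (1 / u) - g m)\<^sup>2 = (max 0 (g m - X m * u))\<^sup>2" if "m \<in> A" for m
  proof -
    have "cmod (h m) * sqrt (p m) / (1 / u) = min (X m * u) (g m)"
      unfolding sp[OF that] using u0 by (simp add: min_def field_simps)
    then have "cmod (h m) * sqrt (p m) / (1 / u) - g m = - max 0 (g m - X m * u)" by linarith
    then show ?thesis by simp
  qed
  then have "(\<Sum>m\<in>A. (cmod (h m) * sqrt (p m) / (1 / u) - g m)\<^sup>2) =
      (\<Sum>m\<in>A. (max 0 (g m - X m * u))\<^sup>2)"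
    by (intro sum.cong) auto
  moreover have "s / (1 / u)\<^sup>2 = s * u\<^sup>2" by (simp add: power_divide)
  ultimately have "ota_objective A g h s p (1 / u) = F u"
    unfolding ota_objective_def F_def by metis
  then have "ota_optimal A g h P s p (1 / u)"
    unfolding ota_optimal_iff using fp lower uv
    by (smt (verit) ota_feasible_def zero_less_divide_1_iff)
  then show ?thesis by blast
qed

end

theory Submission
  imports Defs
begin

text \<open>
  Both regimes follow from comparing the optimum with one explicit feasible point.
  Channel inversion with \<open>\<eta> = \<tau>\<^sub>(\<^sub>1\<^sub>)\<close> has zero misalignment and value \<open>\<sigma>\<^sup>2 / \<tau>\<^sub>(\<^sub>1\<^sub>)\<^sup>2\<close>; hence
  \<open>\<eta>\<^sup>\<star> \<ge> \<tau>\<^sub>(\<^sub>1\<^sub>)\<close>, every misalignment is at most \<open>\<sigma> / \<tau>\<^sub>(\<^sub>1\<^sub>)\<close>, and the misalignment of the device attaining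
  the minimum forces \<open>\<eta>\<^sup>\<star> \<rightarrow> \<tau>\<^sub>(\<^sub>1\<^sub>)\<close>. Full power with \<open>\<eta> = C / D\<close>, where \<open>C\<close> and \<open>D\<close> are
  the numerator and denominator in (ii), has value at most \<open>\<Sum> g\<^sub>m\<^sup>2\<close>, so \<open>1 / \<eta>\<^sup>\<star>\<close> is
  \<open>O(1 / \<sigma>)\<close>. For large \<open>\<sigma>\<close> no device then overshoots its target, so each misalignment is strictly
  decreasing in the power, and the full-power objective is a quadratic in \<open>1 / \<eta>\<close> with
  vertex \<open>D / C\<close>.
\<close>

section \<open>Objective at full power and bounds by single terms\<close>

text \<open>In the variable \<open>u = 1 / e\<close> the full-power objective is a quadratic with
  leading coefficient \<open>C s > 0\<close> and linear coefficient \<open>- 2 * D\<close>;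
  completing the square displays its least value and its vertex \<open>u = D / C s\<close> together.
  The low-SNR argument uses both.\<close>

lemma objective_full_power:
  fixes g :: "'m \<Rightarrow> real" and h :: "'m \<Rightarrow> complex" and P :: "'m \<Rightarrow> real" and A :: "'m set"
  defines "C s \<equiv> (\<Sum>m\<in>A. (cmod (h m))\<^sup>2 * P m) + s"
    and "D \<equiv> \<Sum>m\<in>A. cmod (h m) * sqrt (P m) * g m"
  assumes P: "\<And>m. m \<in> A \<Longrightarrow> P m \<ge> 0" and s: "s > 0"
  shows "ota_objective A g h s P e
    = (\<Sum>m\<in>A. (g m)\<^sup>2) - D\<^sup>2 / C s + C s * (1 / e - D / C s)\<^sup>2"
proof -
  have C: "C s > 0" using P s by (simp add: C_def add_nonneg_pos sum_nonneg)
  have "(cmod (h m) * sqrt (P m) / e - g m)\<^sup>2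
      = (g m)\<^sup>2 - 2 * (1 / e) * (cmod (h m) * sqrt (P m) * g m)
        + (1 / e)\<^sup>2 * ((cmod (h m))\<^sup>2 * P m)" if "m \<in> A" for m
  proof -
    have "(cmod (h m) * sqrt (P m))\<^sup>2 = (cmod (h m))\<^sup>2 * P m"
      using P[OF that] by (simp add: power_mult_distrib)
    moreover have "(x / e - y)\<^sup>2 = y\<^sup>2 - 2 * (1 / e) * (x * y) + (1 / e)\<^sup>2 * x\<^sup>2" for x y :: real
      by (simp add: power2_diff power_divide)
    ultimately show ?thesis by metis
  qed
  then have "(\<Sum>m\<in>A. (cmod (h m) * sqrt (P m) / e - g m)\<^sup>2)
      = (\<Sum>m\<in>A. (g m)\<^sup>2) - 2 * (1 / e) * D + (1 / e)\<^sup>2 * (\<Sum>m\<in>A. (cmod (h m))\<^sup>2 * P m)"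
    unfolding D_def by (simp add: sum.distrib sum_subtractf sum_distrib_left)
  then have "ota_objective A g h s P e = (\<Sum>m\<in>A. (g m)\<^sup>2) - 2 * (1 / e) * D + (1 / e)\<^sup>2 * C s"
    by (simp add: ota_objective_def C_def power_divide algebra_simps add_divide_distrib)
  moreover have "c * (u - d / c)\<^sup>2 = u\<^sup>2 * c - 2 * u * d + d\<^sup>2 / c" if "c > 0" for c d u :: real
    using that by (simp add: power2_eq_square field_simps)
  ultimately show ?thesis using C by simp
qed

lemma misalignment_le_objective:
  assumes "finite A" and "m \<in> A"
  shows "(cmod (h m) * sqrt (p m) / e - g m)\<^sup>2 + s / e\<^sup>2 \<le> ota_objective A g h s p e"
  unfolding ota_objective_def
  using member_le_sum[of m A "\<lambda>m. (cmod (h m) * sqrt (p m) / e - g m)\<^sup>2"] assms by simp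

lemma noise_le_objective: "s / e\<^sup>2 \<le> ota_objective A g h s p e"
  by (simp add: ota_objective_def sum_nonneg)

section \<open>High-SNR regime\<close>

lemma tau_min_pos:
  assumes "finite A" and "A \<noteq> {}" and "\<And>m. m \<in> A \<Longrightarrow> g m > 0"
    and "\<And>m. m \<in> A \<Longrightarrow> h m \<noteq> 0" and "\<And>m. m \<in> A \<Longrightarrow> P m > 0"
  shows "tau_min A g h P > 0"
  using assms by (auto simp: tau_min_def)

lemma optimal_objective_le_inversion:
  assumes fin: "finite A" and ne: "A \<noteq> {}" and g: "\<And>m. m \<in> A \<Longrightarrow> g m > 0"
    and h: "\<And>m. m \<in> A \<Longrightarrow> h m \<noteq> 0" and P: "\<And>m. m \<in> A \<Longrightarrow> P m > 0"
    and opt: "ota_optimal A g h P s p e"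
  shows "ota_objective A g h s p e \<le> s / (tau_min A g h P)\<^sup>2"
proof -
  define \<tau> where "\<tau> = tau_min A g h P"
  have \<tau>: "\<tau> > 0" unfolding \<tau>_def using tau_min_pos[OF fin ne g h P] .
  \<comment> \<open>Channel inversion: this power makes the received amplitude divided by
    \<open>\<tau>\<close> exactly \<open>g m\<close>. It respects every power budget because
    \<open>\<tau>\<close> is the least of the ratios in \<open>tau_min\<close>.\<close>
  define q where "q = (\<lambda>m. (\<tau> * g m / cmod (h m))\<^sup>2)"
  have sq: "sqrt (q m) = \<tau> * g m / cmod (h m)" if "m \<in> A" for m
    using \<tau> g[OF that] by (simp add: q_def)
  have "q m \<le> P m" if m: "m \<in> A" for m
  proof -
    have "\<tau> \<le> cmod (h m) * sqrt (P m) / g m" using fin m by (simp add: \<tau>_def tau_min_def)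
    then have "sqrt (q m) \<le> sqrt (P m)"
      unfolding sq[OF m] using g[OF m] h[OF m] by (simp add: field_simps)
    then show ?thesis by simp
  qed
  then have "ota_feasible A P q \<tau>" using \<tau> by (auto simp: ota_feasible_def q_def)
  then have "ota_objective A g h s p e \<le> ota_objective A g h s q \<tau>"
    using opt by (simp add: ota_optimal_iff)
  also have "\<dots> = s / \<tau>\<^sup>2"
    using \<tau> h by (simp add: ota_objective_def sq)
  finally show ?thesis by (simp add: \<tau>_def)
qed

text \<open>The objective is a sum of nonnegative terms and is bounded by its value at channel
  inversion, so the noise term and each squared misalignment obey that bound separately.\<close>

lemma optimal_high_snr_bounds:
  assumes fin: "finite A" and ne: "A \<noteq> {}" and g: "\<And>m. m \<in> A \<Longrightarrow> g m > 0"
    and h: "\<And>m. m \<in> A \<Longrightarrow> h m \<noteq> 0" and P: "\<And>m. m \<in> A \<Longrightarrow> P m > 0" and s: "s > 0"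
    and opt: "ota_optimal A g h P s p e"
  shows "tau_min A g h P \<le> e"
    and "m \<in> A \<Longrightarrow> \<bar>cmod (h m) * sqrt (p m) / e - g m\<bar> \<le> sqrt s / tau_min A g h P"
proof -
  have \<tau>: "tau_min A g h P > 0" using tau_min_pos[OF fin ne g h P] .
  have e: "e > 0" using opt by (simp add: ota_optimal_iff ota_feasible_def)
  have obj: "ota_objective A g h s p e \<le> s / (tau_min A g h P)\<^sup>2"
    using optimal_objective_le_inversion[OF fin ne g h P opt] .
  have "s / e\<^sup>2 \<le> s / (tau_min A g h P)\<^sup>2" using noise_le_objective obj by (rule order_trans)
  then have "s * (tau_min A g h P)\<^sup>2 \<le> s * e\<^sup>2" using e \<tau> by (simp add: field_simps)
  then have "(tau_min A g h P)\<^sup>2 \<le> e\<^sup>2" using s by simp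
  then show "tau_min A g h P \<le> e"
    by (rule power2_le_imp_le) (use e in simp)
  show "\<bar>cmod (h m) * sqrt (p m) / e - g m\<bar> \<le> sqrt s / tau_min A g h P" if m: "m \<in> A"
  proof -
    have "s / e\<^sup>2 \<ge> 0" using s by simp
    then have "(cmod (h m) * sqrt (p m) / e - g m)\<^sup>2 \<le> s / (tau_min A g h P)\<^sup>2"
      using misalignment_le_objective[OF fin m, of h p e g s] obj by linarith
    from real_sqrt_le_mono[OF this] show ?thesis using \<tau> by (simp add: real_sqrt_divide)
  qed
qed

text \<open>Let \<open>k\<close> attain the minimum in \<open>tau_min\<close>. Its budget caps its
  scaled amplitude at \<open>\<tau> * g k / e\<close>, while the misalignment bound keeps it above
  \<open>g k - sqrt s / \<tau>\<close>. Dividing by \<open>\<tau> * g k\<close> gives the claim with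
  \<open>c = 1 / (\<tau> * g k)\<close>, uniformly in \<open>s\<close>. Bounding
  \<open>1 / e\<close> instead of \<open>e\<close> avoids dividing by \<open>1 - c * sqrt s\<close>,
  which is positive only for small \<open>s\<close> .\<close>

lemma inverse_denoising_lower_bound:
  assumes fin: "finite A" and ne: "A \<noteq> {}" and g: "\<And>m. m \<in> A \<Longrightarrow> g m > 0"
    and h: "\<And>m. m \<in> A \<Longrightarrow> h m \<noteq> 0" and P: "\<And>m. m \<in> A \<Longrightarrow> P m > 0"
  obtains c where "\<And>s p e. s > 0 \<Longrightarrow> ota_optimal A g h P s p e \<Longrightarrow>
    (1 - c * sqrt s) / tau_min A g h P \<le> 1 / e"
proof -
  define \<tau> where "\<tau> = tau_min A g h P"
  have \<tau>: "\<tau> > 0" unfolding \<tau>_def using tau_min_pos[OF fin ne g h P] .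
  have "\<tau> \<in> (\<lambda>m. cmod (h m) * sqrt (P m) / g m) ` A"
    unfolding \<tau>_def tau_min_def using fin ne by (intro Min_in) auto
  then obtain k where k: "k \<in> A" and "\<tau> = cmod (h k) * sqrt (P k) / g k" by auto
  then have gk: "\<tau> * g k = cmod (h k) * sqrt (P k)" using g[OF k] by simp
  have "(1 - 1 / (\<tau> * g k) * sqrt s) / \<tau> \<le> 1 / e"
    if s: "s > 0" and opt: "ota_optimal A g h P s p e" for s p e
  proof -
    have fe: "e > 0" "p k \<le> P k"
      using opt k by (auto simp: ota_optimal_iff ota_feasible_def)
    have "g k - sqrt s / \<tau> \<le> cmod (h k) * sqrt (p k) / e"
      using optimal_high_snr_bounds(2)[OF fin ne g h P s opt k] unfolding \<tau>_def by linarith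
    also have "\<dots> \<le> \<tau> * g k / e"
      unfolding gk using fe by (intro divide_right_mono mult_left_mono) auto
    finally have "(g k - sqrt s / \<tau>) / (\<tau> * g k) \<le> \<tau> * g k / e / (\<tau> * g k)"
      using \<tau> g[OF k] by (intro divide_right_mono) auto
    moreover have "(g k - sqrt s / \<tau>) / (\<tau> * g k) = (1 - 1 / (\<tau> * g k) * sqrt s) / \<tau>"
      using \<tau> g[OF k] by (simp add: field_simps)
    moreover have "\<tau> * g k / e / (\<tau> * g k) = 1 / e" using \<tau> g[OF k] by simp
    ultimately show ?thesis by simp
  qed
  then show ?thesis using that unfolding \<tau>_def by blast
qed

lemma high_snr_limits:
  assumes fin: "finite A" and ne: "A \<noteq> {}" and g: "\<And>m. m \<in> A \<Longrightarrow> g m > 0"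
    and h: "\<And>m. m \<in> A \<Longrightarrow> h m \<noteq> 0" and P: "\<And>m. m \<in> A \<Longrightarrow> P m > 0"
    and opt: "\<And>s. s > 0 \<Longrightarrow> ota_optimal A g h P s (p s) (e s)"
  shows "(e \<longlongrightarrow> tau_min A g h P) (at_right 0)"
    and "m \<in> A \<Longrightarrow> ((\<lambda>s. p s m) \<longlongrightarrow> (tau_min A g h P * g m / cmod (h m))\<^sup>2) (at_right 0)"
proof -
  define \<tau> where "\<tau> = tau_min A g h P"
  have \<tau>: "\<tau> > 0" unfolding \<tau>_def using tau_min_pos[OF fin ne g h P] .
  have e: "e s > 0" if "s > 0" for s
    using opt[OF that] by (simp add: ota_optimal_iff ota_feasible_def)
  have pos: "\<forall>\<^sub>F s in at_right (0::real). s > 0" by (rule eventually_at_right_less)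
  have sqrt0: "(sqrt \<longlongrightarrow> 0) (at_right 0)"
    using tendsto_real_sqrt[OF tendsto_ident_at, of "0::real" "{0<..}"] by simp
  obtain c where "\<And>s q f. s > 0 \<Longrightarrow> ota_optimal A g h P s q f \<Longrightarrow>
      (1 - c * sqrt s) / tau_min A g h P \<le> 1 / f"
    using inverse_denoising_lower_bound[of A g h P, OF fin ne g h P] by blast
  then have c: "(1 - c * sqrt s) / \<tau> \<le> 1 / e s" if "s > 0" for s
    using opt that unfolding \<tau>_def by blast
  \<comment> \<open>The squeeze runs on the reciprocal, where both bounds are available; the limit
    \<open>1 / \<tau>\<close> is nonzero, so it can be inverted afterwards.\<close>
  have "((\<lambda>s. 1 / e s) \<longlongrightarrow> 1 / \<tau>) (at_right 0)"
  proof (rule tendsto_sandwich)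
    show "\<forall>\<^sub>F s in at_right 0. (1 - c * sqrt s) / \<tau> \<le> 1 / e s"
      using pos by eventually_elim (rule c)
    show "\<forall>\<^sub>F s in at_right 0. 1 / e s \<le> 1 / \<tau>"
      using pos
    proof eventually_elim
      case (elim s)
      have "\<tau> \<le> e s"
        unfolding \<tau>_def using optimal_high_snr_bounds(1)[OF fin ne g h P elim opt[OF elim]] .
      then show ?case using \<tau> by (simp add: frac_le)
    qed
    have "((\<lambda>s. (1 - c * sqrt s) / \<tau>) \<longlongrightarrow> (1 - c * 0) / \<tau>) (at_right 0)"
      using \<tau> by (intro tendsto_intros sqrt0) auto
    then show "((\<lambda>s. (1 - c * sqrt s) / \<tau>) \<longlongrightarrow> 1 / \<tau>) (at_right 0)" by simp
  qed auto
  moreover have "1 / \<tau> \<noteq> 0" using \<tau> by simp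
  ultimately have "((\<lambda>s. 1 / (1 / e s)) \<longlongrightarrow> 1 / (1 / \<tau>)) (at_right 0)"
    by (rule tendsto_divide[OF tendsto_const])
  then have lim_e: "(e \<longlongrightarrow> \<tau>) (at_right 0)"
    by (simp only: divide_divide_eq_right mult_1 div_by_1)
  then show "(e \<longlongrightarrow> tau_min A g h P) (at_right 0)" by (simp add: \<tau>_def)
  show "((\<lambda>s. p s m) \<longlongrightarrow> (tau_min A g h P * g m / cmod (h m))\<^sup>2) (at_right 0)" if m: "m \<in> A"
  proof -
    define y where "y = (\<lambda>s. cmod (h m) * sqrt (p s m) / e s)"
    have "((\<lambda>s. y s - g m) \<longlongrightarrow> 0) (at_right 0)"
    proof (rule Lim_null_comparison)
      show "\<forall>\<^sub>F s in at_right 0. norm (y s - g m) \<le> sqrt s / \<tau>"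
        using pos
      proof eventually_elim
        case (elim s)
        show ?case
          using optimal_high_snr_bounds(2)[OF fin ne g h P elim opt[OF elim] m]
          by (simp add: y_def \<tau>_def)
      qed
      show "((\<lambda>s. sqrt s / \<tau>) \<longlongrightarrow> 0) (at_right 0)"
        using tendsto_divide[OF sqrt0 tendsto_const, of \<tau>] \<tau> by simp
    qed
    then have "(y \<longlongrightarrow> g m) (at_right 0)" by (simp add: LIM_zero_iff)
    \<comment> \<open>For \<open>s > 0\<close> the power is recovered from the scaled amplitude as
      \<open>(e s * y s / cmod (h m))\<^sup>2\<close>, so its limit follows from those of
      \<open>e\<close> and \<open>y\<close>.\<close>
    then have "((\<lambda>s. (e s * y s / cmod (h m))\<^sup>2) \<longlongrightarrow> (\<tau> * g m / cmod (h m))\<^sup>2) (at_right 0)"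
      using h[OF m] by (intro tendsto_intros lim_e) auto
    moreover have "\<forall>\<^sub>F s in at_right 0. (e s * y s / cmod (h m))\<^sup>2 = p s m"
      using pos
    proof eventually_elim
      case (elim s)
      have "0 \<le> p s m" using opt[OF elim] m by (simp add: ota_optimal_iff ota_feasible_def)
      then show ?case using e[OF elim] h[OF m] by (simp add: y_def)
    qed
    ultimately show ?thesis unfolding \<tau>_def by (rule Lim_transform_eventually)
  qed
qed

section \<open>Low-SNR regime\<close>

text \<open>The threshold \<open>large\<close> is chosen to fit the bound
  \<open>s \<le> G * e\<^sup>2\<close>: together they put \<open>e\<close> above every ratio
  \<open>cmod (h m) * sqrt (P m) / g m\<close>, so that even full power does not overshoot.\<close>

lemma low_snr_optimum:
  fixes g :: "'m \<Rightarrow> real" and h :: "'m \<Rightarrow> complex"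
  assumes fin: "finite A" and ne: "A \<noteq> {}" and g: "\<And>m. m \<in> A \<Longrightarrow> g m > 0"
    and h: "\<And>m. m \<in> A \<Longrightarrow> h m \<noteq> 0" and P: "\<And>m. m \<in> A \<Longrightarrow> P m > 0" and s: "s > 0"
    and opt: "ota_optimal A g h P s p e"
    and large: "\<And>m. m \<in> A \<Longrightarrow> (cmod (h m) * sqrt (P m) / g m)\<^sup>2 * (\<Sum>m\<in>A. (g m)\<^sup>2) \<le> s"
  shows "\<forall>m\<in>A. p m = P m"
    and "e = ((\<Sum>m\<in>A. (cmod (h m))\<^sup>2 * P m) + s) / (\<Sum>m\<in>A. cmod (h m) * sqrt (P m) * g m)"
proof -
  define G where "G = (\<Sum>m\<in>A. (g m)\<^sup>2)"
  define C where "C = (\<Sum>m\<in>A. (cmod (h m))\<^sup>2 * P m) + s"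
  define D where "D = (\<Sum>m\<in>A. cmod (h m) * sqrt (P m) * g m)"
  have C: "C > 0" using P s by (simp add: C_def add_nonneg_pos sum_nonneg less_imp_le)
  have D: "D > 0" using fin ne g h P by (auto simp: D_def intro!: sum_pos)
  have e: "e > 0" and p: "\<And>m. m \<in> A \<Longrightarrow> 0 \<le> p m \<and> p m \<le> P m"
    using opt by (auto simp: ota_optimal_iff ota_feasible_def)
  have full: "ota_objective A g h s P f = G - D\<^sup>2 / C + C * (1 / f - D / C)\<^sup>2" for f
    unfolding G_def C_def D_def using P s by (intro objective_full_power) (auto intro: less_imp_le)
  \<comment> \<open>At \<open>C / D\<close> the square in \<open>full\<close> vanishes, leaving the
    least full-power value.\<close>
  have "ota_feasible A P P (C / D)" using C D P by (auto simp: ota_feasible_def less_imp_le)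
  then have "ota_objective A g h s p e \<le> ota_objective A g h s P (C / D)"
    using opt by (simp add: ota_optimal_iff)
  then have le: "ota_objective A g h s p e \<le> G - D\<^sup>2 / C" by (simp add: full)
  have "D\<^sup>2 / C \<ge> 0" using C by simp
  then have "s / e\<^sup>2 \<le> G" using noise_le_objective[of s e A g h p] le by linarith
  then have sG: "s \<le> G * e\<^sup>2" using e by (simp add: field_simps)
  have "G > 0" unfolding G_def using fin ne g by (intro sum_pos zero_less_power)
  have under: "cmod (h m) * sqrt (P m) / e \<le> g m" if m: "m \<in> A" for m
  proof -
    have "(cmod (h m) * sqrt (P m) / g m)\<^sup>2 * G \<le> e\<^sup>2 * G"
      using large[OF m] sG unfolding G_def by (simp add: mult.commute)
    then have "(cmod (h m) * sqrt (P m) / g m)\<^sup>2 \<le> e\<^sup>2" using \<open>G > 0\<close> by simp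
    then have "cmod (h m) * sqrt (P m) / g m \<le> e"
      by (rule power2_le_imp_le) (use e in simp)
    then have "cmod (h m) * sqrt (P m) \<le> e * g m"
      using g[OF m] by (simp only: pos_divide_le_eq)
    then show ?thesis using e by (simp add: pos_divide_le_eq mult.commute)
  qed
  have mono: "cmod (h m) * sqrt (p m) / e \<le> cmod (h m) * sqrt (P m) / e" if "m \<in> A" for m
    using p[OF that] e by (intro divide_right_mono mult_left_mono) auto
  \<comment> \<open>With \<open>e\<close> held fixed, \<open>d m\<close> is the cost of device
    \<open>m\<close> using \<open>p m\<close> in place of \<open>P m\<close>. Without overshoot it
    cannot be negative.\<close>
  define d where "d m = (cmod (h m) * sqrt (p m) / e - g m)\<^sup>2
    - (cmod (h m) * sqrt (P m) / e - g m)\<^sup>2" for m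
  have d: "d m \<ge> 0" if "m \<in> A" for m
  proof -
    have "\<bar>cmod (h m) * sqrt (P m) / e - g m\<bar> \<le> \<bar>cmod (h m) * sqrt (p m) / e - g m\<bar>"
      using mono[OF that] under[OF that] by linarith
    then show ?thesis by (simp add: d_def abs_le_square_iff)
  qed
  have "ota_objective A g h s p e = ota_objective A g h s P e + (\<Sum>m\<in>A. d m)"
    by (simp add: ota_objective_def d_def sum_subtractf)
  \<comment> \<open>The terms \<open>G - D\<^sup>2 / C\<close> cancel. Two nonnegative quantities
    remain, so both vanish: one fixes \<open>e\<close>, the other the powers.\<close>
  then have "(\<Sum>m\<in>A. d m) + C * (1 / e - D / C)\<^sup>2 \<le> 0" using le full[of e] by linarith
  moreover have "(\<Sum>m\<in>A. d m) \<ge> 0" using d by (rule sum_nonneg)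
  moreover have "C * (1 / e - D / C)\<^sup>2 \<ge> 0" using C by simp
  ultimately have d0: "(\<Sum>m\<in>A. d m) = 0" and "C * (1 / e - D / C)\<^sup>2 = 0" by linarith+
  then have "1 / e = D / C" using C by simp
  then have "e = C / D" using C D e by (simp add: field_simps)
  then show "e = ((\<Sum>m\<in>A. (cmod (h m))\<^sup>2 * P m) + s) / (\<Sum>m\<in>A. cmod (h m) * sqrt (P m) * g m)"
    by (simp add: C_def D_def)
  show "\<forall>m\<in>A. p m = P m"
  proof
    fix m assume m: "m \<in> A"
    have "d m = 0" using d0 d m fin by (simp add: sum_nonneg_eq_0_iff)
    then have "\<bar>cmod (h m) * sqrt (p m) / e - g m\<bar> = \<bar>cmod (h m) * sqrt (P m) / e - g m\<bar>"
      by (simp add: d_def power2_eq_iff abs_eq_iff)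
    \<comment> \<open>Both differences are nonpositive, which rules out the solution with opposite
      signs.\<close>
    then have "cmod (h m) * sqrt (p m) / e = cmod (h m) * sqrt (P m) / e"
      using mono[OF m] under[OF m] by linarith
    then show "p m = P m" using e h[OF m] by simp
  qed
qed

theorem mainTheorem5:
  fixes A :: "'m set"
    and g :: "'m \<Rightarrow> real" and h :: "'m \<Rightarrow> complex" and P :: "'m \<Rightarrow> real"
    and p_opt :: "real \<Rightarrow> 'm \<Rightarrow> real" and \<eta>_opt :: "real \<Rightarrow> real"
  assumes "finite A" and "A \<noteq> {}"
    and "\<And>m. m \<in> A \<Longrightarrow> g m > 0"
    and "\<And>m. m \<in> A \<Longrightarrow> h m \<noteq> 0"
    and "\<And>m. m \<in> A \<Longrightarrow> P m > 0"
    and "\<And>\<sigma>2. \<sigma>2 > 0 \<Longrightarrow> ota_optimal A g h P \<sigma>2 (p_opt \<sigma>2) (\<eta>_opt \<sigma>2)"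
  shows "((\<eta>_opt \<longlongrightarrow> tau_min A g h P) (at_right 0) \<and>
          (\<forall>m\<in>A. ((\<lambda>\<sigma>2. p_opt \<sigma>2 m) \<longlongrightarrow> (tau_min A g h P * g m / cmod (h m))\<^sup>2) (at_right 0))) \<and>
         (\<forall>\<^sub>F \<sigma>2 in at_top.
            (\<forall>m\<in>A. p_opt \<sigma>2 m = P m) \<and>
            \<eta>_opt \<sigma>2 = ((\<Sum>m\<in>A. (cmod (h m))\<^sup>2 * P m) + \<sigma>2)
                         / (\<Sum>m\<in>A. cmod (h m) * sqrt (P m) * g m))"
proof (intro conjI ballI)
  show "(\<eta>_opt \<longlongrightarrow> tau_min A g h P) (at_right 0)"
    by (rule high_snr_limits(1)[OF assms])
  show "((\<lambda>\<sigma>2. p_opt \<sigma>2 m) \<longlongrightarrow> (tau_min A g h P * g m / cmod (h m))\<^sup>2) (at_right 0)"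
    if "m \<in> A" for m
    by (rule high_snr_limits(2)[OF assms that])
  \<comment> \<open>Each device imposes one constant threshold; since \<open>A\<close> is finite,
    they all hold eventually.\<close>
  have "\<forall>\<^sub>F \<sigma>2 in at_top. \<forall>m\<in>A.
      (cmod (h m) * sqrt (P m) / g m)\<^sup>2 * (\<Sum>m\<in>A. (g m)\<^sup>2) \<le> \<sigma>2"
    using assms(1) by (intro eventually_ball_finite ballI eventually_ge_at_top)
  with eventually_gt_at_top[of 0]
  show "\<forall>\<^sub>F \<sigma>2 in at_top.
      (\<forall>m\<in>A. p_opt \<sigma>2 m = P m) \<and>
      \<eta>_opt \<sigma>2 = ((\<Sum>m\<in>A. (cmod (h m))\<^sup>2 * P m) + \<sigma>2)
                   / (\<Sum>m\<in>A. cmod (h m) * sqrt (P m) * g m)"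
  proof eventually_elim
    case (elim \<sigma>2)
    then show ?case using low_snr_optimum[OF assms(1-5) elim(1) assms(6)[OF elim(1)]] by blast
  qed
qed

end
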